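(* There exists an absolute constant $c>0$ such that the following holds. If $A\subseteq[N]$ is a set and $B$ is a subset of $[1,c|A|^2]$ consisting of pairwise coprime integers, none of which divides a member of $\Sigma^*(A)$, then $$|A|\sum_{b\in B}\frac{\log b}{b}\ll \log N,$$ where the implied constant is absolute.
   Context: $[N]=\{1,\dots,N\}$. For a set $A$ of integers, $\Sigma^*(A)$ denotes the set of sums $\sum_{a\in A'}a$ over nonempty subsets $A'\subseteq A$. $X\ll Y$ means $|X|\le CY$ for an absolute constant $C$. *)

theory Defs
  imports Complex_Main
begin

definition subset_sums :: "int set \<Rightarrow> int set" where
  "subset_sums A = {\<Sum>A' | A'. A' \<subseteq> A \<and> finite A' \<and> A' \<noteq> {}}"

end

theory Submission
  imports Defs "HOL-Analysis.Convex"
begin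

text \<open>
  Let \<open>n = |A|\<close>. It suffices to find, for each \<open>b\<close> in \<open>B\<close>, at least a constant times \<open>n\<^sup>3 / b\<close> pairs of
  distinct elements of \<open>A\<close> that are congruent modulo \<open>b\<close>: as in Gallagher's larger sieve, coprimality
  gives \<open>\<Sum> ln b \<le> ln |x - y| \<le> ln N\<close>, summed over the \<open>b\<close> dividing \<open>x - y\<close>, and one sums over all pairs.

  To find the pairs, replace the integers modulo \<open>b\<close> by the subgroup \<open>H\<close> maximising \<open>|A \<inter> H|\<^sup>3 / |H|\<close>,
  so that every subset of \<open>A \<inter> H\<close> containing four fifths of it generates \<open>H\<close>. Build the set \<open>X\<close> of subset
  sums greedily. Adding an element \<open>x\<close> enlarges \<open>X\<close> by the defect \<open>|(X + x) - X|\<close>, which is subadditive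
  in \<open>x\<close> and of order \<open>|X|\<close> for an average element of \<open>H\<close> as long as \<open>|X|\<close> is at most about half of \<open>|H|\<close>;
  hence if the unused elements occupy \<open>d\<close> residue classes, one of them has defect of order \<open>min |X| d\<close>.
  After a number of steps proportional to \<open>|A \<inter> H|\<close> this yields \<open>|H| \<ge> const * |A \<inter> H| * d\<close>, so a large
  part of \<open>A \<inter> H\<close> lies in \<open>O(|H| / |A \<inter> H|)\<close> classes, and Cauchy--Schwarz counts the coincidences.
\<close>

section \<open>Translation defects of sets of residues\<close>

definition shift_defect :: "int \<Rightarrow> int set \<Rightarrow> int \<Rightarrow> nat" where
  "shift_defect m X g = card {x \<in> X. (x + g) mod m \<notin> X}"

text \<open>Unlike in \<open>subset_sums\<close>, the empty sum is included, so that 0 is always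
  present and inserting a new \<open>x\<close> into a finite \<open>T\<close> adjoins exactly the
  translate by \<open>x\<close>.\<close>

definition residue_sums :: "int \<Rightarrow> int set \<Rightarrow> int set" where
  "residue_sums m T = (\<lambda>S. \<Sum>S mod m) ` Pow T"

lemma inj_on_shift_mod:
  fixes m g :: int
  assumes "V \<subseteq> {0..<m}"
  shows "inj_on (\<lambda>x. (x + g) mod m) V"
proof (rule inj_onI)
  fix x y assume "x \<in> V" "y \<in> V" and eq: "(x + g) mod m = (y + g) mod m"
  then have "0 \<le> x" "x < m" "0 \<le> y" "y < m" using assms by auto
  moreover have "x mod m = y mod m"
    using eq by (metis add_diff_cancel_right' mod_diff_left_eq)
  ultimately show "x = y" by simp
qed

text \<open>An element that leaves \<open>X\<close> under \<open>g + h\<close> either leaves under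
  \<open>g\<close>, or stays in \<open>X\<close> and then leaves under \<open>h\<close>. Translation
  by \<open>g\<close> injects the second kind into the elements counted for
  \<open>h\<close>.\<close>

lemma shift_defect_add_le:
  assumes X: "X \<subseteq> {0..<m}"
  shows "shift_defect m X (g + h) \<le> shift_defect m X g + shift_defect m X h"
proof -
  let ?f = "\<lambda>x. (x + g) mod m"
  let ?P = "{x \<in> X. ?f x \<notin> X}"
  let ?Q = "{x \<in> X. ?f x \<in> X \<and> (?f x + h) mod m \<notin> X}"
  have fin: "finite X" using X finite_subset by blast
  have "{x \<in> X. (x + (g + h)) mod m \<notin> X} \<subseteq> ?P \<union> ?Q"
    by (auto simp: mod_add_left_eq add.assoc)
  then have "shift_defect m X (g + h) \<le> card (?P \<union> ?Q)"
    unfolding shift_defect_def using fin by (intro card_mono) auto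
  also have "\<dots> \<le> card ?P + card ?Q" by (rule card_Un_le)
  also have "card ?Q = card (?f ` ?Q)"
    by (rule card_image[symmetric]) (rule inj_on_shift_mod, use X in auto)
  also have "\<dots> \<le> card {x \<in> X. (x + h) mod m \<notin> X}"
    using fin by (intro card_mono) auto
  finally show ?thesis unfolding shift_defect_def by simp
qed

lemma shift_defect_mod: "shift_defect m X (g mod m) = shift_defect m X g"
  unfolding shift_defect_def by (simp add: mod_add_right_eq)

lemma shift_defect_0: "X \<subseteq> {0..<m} \<Longrightarrow> shift_defect m X 0 = 0"
  unfolding shift_defect_def by (force intro: card_eq_0_iff[THEN iffD2])

section \<open>Subgroups of the integers\<close>

lemma additive_subgroup_int_generator:
  fixes P :: "int set"
  assumes m: "m \<in> P" "m > 0" and diff: "\<And>x y. x \<in> P \<Longrightarrow> y \<in> P \<Longrightarrow> x - y \<in> P"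
  obtains d where "d > 0" "d \<in> P" "\<And>x. x \<in> P \<Longrightarrow> d dvd x"
proof -
  define e where "e = (LEAST k. k > 0 \<and> int k \<in> P)"
  have "\<exists>k. k > 0 \<and> int k \<in> P" using m by (intro exI[of _ "nat m"]) auto
  then have e: "e > 0" "int e \<in> P" unfolding e_def by (metis (mono_tags, lifting) LeastI)+
  have zero: "0 \<in> P" using diff[OF m(1) m(1)] by simp
  have neg: "- x \<in> P" if "x \<in> P" for x using diff[OF zero that] by simp
  have add: "x + y \<in> P" if "x \<in> P" "y \<in> P" for x y using diff[OF that(1) neg[OF that(2)]] by simp
  have nmul: "int k * x \<in> P" if "x \<in> P" for k x
    by (induction k) (use zero add that in \<open>auto simp: algebra_simps\<close>)
  have zmul: "k * x \<in> P" if "x \<in> P" for k x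
    by (cases k) (use nmul[OF that] neg nmul[OF neg[OF that]] in \<open>auto simp del: of_nat_Suc\<close>)
  have "int e dvd x" if x: "x \<in> P" for x
  proof (rule ccontr)
    assume nd: "\<not> int e dvd x"
    have "x mod int e = x - (x div int e) * int e" by (simp add: minus_div_mult_eq_mod)
    then have "x mod int e \<in> P" using diff[OF x zmul[OF e(2)]] by simp
    moreover have "x mod int e > 0" using nd e(1)
      by (metis dvd_eq_mod_eq_0 of_nat_0_less_iff order_neq_le_trans pos_mod_sign)
    ultimately have "nat (x mod int e) > 0 \<and> int (nat (x mod int e)) \<in> P" by auto
    then have "e \<le> nat (x mod int e)" unfolding e_def by (rule Least_le)
    moreover have "x mod int e < int e" using e(1) by simp
    ultimately show False using e(1) by linarith
  qed
  then show ?thesis using that[of "int e"] e by auto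
qed

text \<open>The shifts that map \<open>D\<close> into itself form a subgroup of the integers
  containing \<open>m\<close> and \<open>W\<close>. Its positive generator divides \<open>m\<close>
  and every element of \<open>W\<close>, so \<open>gen\<close> forces it to be 1.\<close>

lemma closed_under_generating_shifts:
  fixes D W :: "int set"
  assumes m: "m > 0" and zero: "0 \<in> D"
    and per: "\<And>g k. g \<in> D \<Longrightarrow> g + k * m \<in> D"
    and closed: "\<And>g w. g \<in> D \<Longrightarrow> w \<in> W \<Longrightarrow> g + w \<in> D"
    and gen: "\<And>q. q > 1 \<Longrightarrow> q dvd m \<Longrightarrow> \<exists>w\<in>W. \<not> q dvd w"
  shows "D = UNIV"
proof -
  define P where "P = {p. \<forall>g\<in>D. g + p \<in> D}"
  have Pm: "k * m \<in> P" for k using per unfolding P_def by auto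
  have add: "x + y \<in> P" if "x \<in> P" "y \<in> P" for x y
    using that unfolding P_def by (auto simp: add.assoc[symmetric])
  have nmul: "int k * x \<in> P" if "x \<in> P" for k x
  proof (induction k)
    case 0 then show ?case unfolding P_def by simp
  next
    case (Suc k) then show ?case using add[OF that Suc] by (simp add: algebra_simps)
  qed
  have neg: "- x \<in> P" if "x \<in> P" for x
  proof -
    \<comment> \<open>Closure under addition yields inverses because \<open>-x\<close> is congruent
      to \<open>(m - 1) * x\<close> modulo \<open>m\<close>.\<close>
    have "int (nat (m - 1)) * x + (- x) * m \<in> P" by (intro add nmul that Pm)
    then show ?thesis using m by (simp add: algebra_simps)
  qed
  have diff: "x - y \<in> P" if "x \<in> P" "y \<in> P" for x y using add[OF that(1) neg[OF that(2)]] by simp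
  obtain d where d: "d > 0" "d \<in> P" "\<And>x. x \<in> P \<Longrightarrow> d dvd x"
    using additive_subgroup_int_generator[of m P] Pm[of 1] m diff by auto
  have "W \<subseteq> P" using closed unfolding P_def by auto
  then have "\<not> d > 1" using gen[of d] d(3) Pm[of 1] by auto
  then have "1 \<in> P" using d by (metis int_one_le_iff_zero_less order_le_less)
  then have nat: "int k \<in> P" for k using nmul[of 1 k] by simp
  have "x \<in> D" for x
  proof -
    have "x \<in> P" using nat[of "nat x"] neg[OF nat[of "nat (-x)"]] by (cases "x \<ge> 0") auto
    then show ?thesis using zero unfolding P_def by force
  qed
  then show ?thesis by auto
qed

section \<open>Finding elements with large defect\<close>

lemma card_eq_shift_defect_add:
  assumes "finite X"
  shows "card X = shift_defect m X g + card {x \<in> X. (x + g) mod m \<in> X}"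
proof -
  have "X = {x \<in> X. (x + g) mod m \<notin> X} \<union> {x \<in> X. (x + g) mod m \<in> X}" by auto
  then have "card X = card ({x \<in> X. (x + g) mod m \<notin> X} \<union> {x \<in> X. (x + g) mod m \<in> X})" by simp
  also have "\<dots> = shift_defect m X g + card {x \<in> X. (x + g) mod m \<in> X}"
    unfolding shift_defect_def using assms by (intro card_Un_disjoint) auto
  finally show ?thesis .
qed

text \<open>Translation by \<open>g\<close> injects the elements that stay in \<open>X\<close> under
  \<open>g\<close> into those that stay under \<open>-g\<close>; the defects count the
  complements.\<close>

lemma shift_defect_minus_le:
  assumes X: "X \<subseteq> {0..<m}"
  shows "shift_defect m X (- g) \<le> shift_defect m X g"
proof -
  let ?f = "\<lambda>x. (x + g) mod m"
  have fX: "finite X" using X finite_subset by blast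
  have unshift: "((x + g) mod m - g) mod m = x" if "x \<in> X" for x
  proof -
    have "((x + g) mod m - g) mod m = x mod m" by (simp only: mod_diff_left_eq) simp
    then show ?thesis using that X by (auto simp: subset_iff)
  qed
  have "card {x \<in> X. ?f x \<in> X} \<le> card {x \<in> X. (x + - g) mod m \<in> X}"
    by (rule card_inj_on_le[of ?f], rule inj_on_shift_mod) (use X fX unshift in auto)
  then show ?thesis
    using card_eq_shift_defect_add[OF fX, of m g] card_eq_shift_defect_add[OF fX, of m "- g"] by linarith
qed

text \<open>Double counting of the pairs \<open>(g, x)\<close> with \<open>x + g\<close> in
  \<open>X\<close> modulo \<open>m\<close>: each \<open>g\<close> has at least
  \<open>card X - K\<close> partners, each \<open>x\<close> at most \<open>card X\<close>.\<close>

lemma card_mul_le_of_shift_defect_le: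
  assumes X: "X \<subseteq> {0..<m}" and V: "V \<subseteq> {0..<m}"
    and K: "\<And>g. g \<in> V \<Longrightarrow> shift_defect m X g \<le> K"
  shows "card V * card X \<le> card V * K + card X * card X"
proof -
  have fX: "finite X" and fV: "finite V" using X V finite_subset by blast+
  have "card V * card X = (\<Sum>g\<in>V. shift_defect m X g + card {x \<in> X. (x + g) mod m \<in> X})"
    using card_eq_shift_defect_add[OF fX] by simp
  also have "\<dots> = (\<Sum>g\<in>V. shift_defect m X g) + (\<Sum>g\<in>V. card {x \<in> X. (x + g) mod m \<in> X})"
    by (simp add: sum.distrib)
  also have "(\<Sum>g\<in>V. shift_defect m X g) \<le> card V * K"
    using sum_mono[of V "shift_defect m X" "\<lambda>_. K"] K by simp
  also have "(\<Sum>g\<in>V. card {x \<in> X. (x + g) mod m \<in> X}) = (\<Sum>x\<in>X. card {g \<in> V. (x + g) mod m \<in> X})"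
    using sum_multicount_gen[OF fV fX, of "\<lambda>g x. (x + g) mod m \<in> X" "\<lambda>x. card {g \<in> V. (x + g) mod m \<in> X}"]
    by simp
  also have "\<dots> \<le> (\<Sum>x\<in>X. card X)"
  proof (rule sum_mono)
    fix x assume "x \<in> X"
    have "inj_on (\<lambda>g. (x + g) mod m) {g \<in> V. (x + g) mod m \<in> X}"
      using inj_on_shift_mod[of "{g \<in> V. (x + g) mod m \<in> X}" m x] V by (auto simp: add.commute)
    then show "card {g \<in> V. (x + g) mod m \<in> X} \<le> card X"
      by (rule card_inj_on_le) (use fX in auto)
  qed
  finally show ?thesis by simp
qed

text \<open>With \<open>k\<close> the largest defect on \<open>W\<close>, a radius of order
  \<open>card X / d + 1\<close> reaches nearly \<open>2 * card X\<close> residues; the bound on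
  \<open>card X\<close> leaves room for them. Averaging over them forces the defect bound at that
  radius, a multiple of \<open>k\<close>, to be at least \<open>card X / 3\<close>.\<close>

lemma exists_large_shift_defect:
  assumes X: "X \<subseteq> {0..<m}" and X2: "2 \<le> card X" "2 * int (card X) \<le> m + 1"
    and W: "finite W" and d: "0 < d" "d \<le> card ((\<lambda>w. w mod m) ` W)"
    and gen: "\<And>q. q > 1 \<Longrightarrow> q dvd m \<Longrightarrow> \<exists>w\<in>W. \<not> q dvd w"
  shows "\<exists>w\<in>W. min (card X) d \<le> 21 * shift_defect m X w"
proof -
  have m: "m > 0" using X2 by linarith
  define k where "k = Max (shift_defect m X ` W)"
  have "W \<noteq> {}" using d by auto
  then have "k \<in> shift_defect m X ` W" unfolding k_def using W by (intro Max_in) auto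
  then obtain w0 where w0: "w0 \<in> W" "k = shift_defect m X w0" by auto
  have k: "shift_defect m X w \<le> k" if "w \<in> W" for w unfolding k_def using W that by auto
  \<comment> \<open>By subadditivity of the defect the sets \<open>B j\<close> behave like the balls of radius \<open>j\<close> of a Cayley
    graph with generators \<open>W\<close>, so they grow at least linearly until they exhaust the group.\<close>
  define B where "B j = {g \<in> {0..<m}. shift_defect m X g \<le> j * k}" for j
  have Bsub: "B j \<subseteq> {0..<m}" for j unfolding B_def by auto
  have finB: "finite (B j)" for j using Bsub finite_subset by blast
  have Badd: "(g + h) mod m \<in> B (i + j)" if "g \<in> B i" "shift_defect m X h \<le> j * k" for g h i j
    using that shift_defect_add_le[OF X, of g h] m unfolding B_def
    by (auto simp: shift_defect_mod algebra_simps)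
  have Wm: "(\<lambda>w. w mod m) ` W \<subseteq> B 1" using k m unfolding B_def by (auto simp: shift_defect_mod)
  \<comment> \<open>When a ball stops growing, its preimage in the integers is closed under adding
    elements of \<open>W\<close>.\<close>
  have full: "B j = {0..<m}" if eq: "B (Suc j) = B j" for j
  proof -
    have "{g. g mod m \<in> B j} = UNIV"
    proof (rule closed_under_generating_shifts[OF m _ _ _ gen])
      show "0 \<in> {g. g mod m \<in> B j}" unfolding B_def using m shift_defect_0[OF X] by simp
      show "g + w \<in> {g. g mod m \<in> B j}" if "g \<in> {g. g mod m \<in> B j}" "w \<in> W" for g w
        using Badd[of "g mod m" j w 1] that k eq by (simp add: mod_add_left_eq)
    qed auto
    then have "g \<in> B j" if "g \<in> {0..<m}" for g
    proof -
      have "g mod m \<in> B j" using \<open>_ = UNIV\<close> by blast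
      then show ?thesis using that by simp
    qed
    then show ?thesis using Bsub by blast
  qed
  \<comment> \<open>Three units of radius gain \<open>d\<close> residues: if \<open>g\<close> has
    radius \<open>3 * i + 3\<close> but not \<open>3 * i + 2\<close>, then \<open>g + W\<close> lies
    within radius \<open>3 * i + 4\<close> and misses radius \<open>3 * i + 1\<close>, since
    subtracting an element of \<open>W\<close> costs one unit.\<close>
  have grow: "min (nat m) ((i + 1) * d) \<le> card (B (3 * i + 1))" for i
  proof (induction i)
    case 0
    then show ?case using card_mono[OF finB Wm] d by simp
  next
    case (Suc i)
    let ?j = "3 * i + 1"
    have mono: "B i \<subseteq> B j" if "i \<le> j" for i j
      unfolding B_def using mult_right_mono[OF that, of k] by (auto intro: order_trans)
    show ?case
    proof (cases "B (Suc (Suc ?j)) = B (Suc ?j)")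
      case True
      then have "B (Suc ?j) = {0..<m}" by (rule full)
      moreover have "B (Suc ?j) \<subseteq> B (3 * Suc i + 1)" by (rule mono) simp
      ultimately have "B (3 * Suc i + 1) = {0..<m}" using Bsub by blast
      then show ?thesis by simp
    next
      case False
      then obtain g where g: "g \<in> B (Suc (Suc ?j))" "g \<notin> B (Suc ?j)"
        using mono[of "Suc ?j" "Suc (Suc ?j)"] by auto
      let ?S = "(\<lambda>x. (x + g) mod m) ` (\<lambda>w. w mod m) ` W"
      have cS: "card ?S = card ((\<lambda>w. w mod m) ` W)"
        by (intro card_image inj_on_shift_mod) (use m in auto)
      have sub: "?S \<subseteq> B (3 * Suc i + 1)"
      proof
        fix y assume "y \<in> ?S"
        then obtain w where w: "w \<in> W" "y = (g + w) mod m" by (auto simp: mod_add_left_eq add.commute[of _ g] mod_add_right_eq)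
        then have "y \<in> B (Suc (Suc ?j) + 1)" using Badd[OF g(1), of w 1] k by simp
        then show "y \<in> B (3 * Suc i + 1)" by (simp add: eval_nat_numeral)
      qed
      have disj: "?S \<inter> B ?j = {}"
      proof (rule ccontr)
        assume "?S \<inter> B ?j \<noteq> {}"
        then obtain w where w: "w \<in> W" "(g + w) mod m \<in> B ?j" by (auto simp: mod_add_left_eq add.commute[of _ g] mod_add_right_eq)
        have "((g + w) mod m + (- w)) mod m \<in> B (?j + 1)"
          using Badd[OF w(2), of "- w" 1] k[OF w(1)] shift_defect_minus_le[OF X, of w] by simp
        moreover have "((g + w) mod m + (- w)) mod m = g mod m" by (simp only: mod_add_left_eq) simp
        moreover have "g mod m = g" using g Bsub by force
        ultimately show False using g(2) by simp
      qed
      have "card ?S + card (B ?j) = card (?S \<union> B ?j)"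
        using disj W finB by (intro card_Un_disjoint[symmetric]) auto
      also have "\<dots> \<le> card (B (3 * Suc i + 1))"
        using sub mono[of ?j "3 * Suc i + 1"] by (intro card_mono finB) auto
      finally show ?thesis using Suc cS d by (simp add: algebra_simps min_def split: if_splits)
    qed
  qed
  define x where "x = card X"
  define i where "i = 2 * x div d"
  let ?V = "B (3 * i + 1)"
  have "(i + 1) * d > 2 * x" unfolding i_def using d(1)
    by (metis Suc_eq_plus1 dividend_less_div_times add.commute mult.commute mult_Suc_right)
  \<comment> \<open>The \<open>+ 1\<close> covers the case \<open>m = 2 * x - 1\<close>, where the
    ball may be the whole group.\<close>
  then have V: "2 * x \<le> card ?V + 1" using grow[of i] X2 by (auto simp: x_def min_def split: if_splits)
  define K where "K = (3 * i + 1) * k"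
  have "card ?V * x \<le> card ?V * K + x * x"
    unfolding x_def K_def by (rule card_mul_le_of_shift_defect_le[OF X Bsub]) (auto simp: B_def)
  \<comment> \<open>If \<open>3 * K < x\<close>, averaging would give
    \<open>(2 * x - 1) * (2 * x + 1) <= 3 * x^2\<close>, impossible for
    \<open>x >= 2\<close>.\<close>
  have K3: "x \<le> 3 * K"
  proof (rule ccontr)
    assume "\<not> x \<le> 3 * K"
    then have a: "int x \<ge> 3 * int K + 1" by linarith
    have v: "int (card ?V) \<ge> 2 * int x - 1" using V by linarith
    have "int (card ?V) * (int x - int K) \<le> int x * int x"
      using \<open>card ?V * x \<le> card ?V * K + x * x\<close>[THEN of_nat_mono[where 'a = int]]
      by (simp add: right_diff_distrib)
    moreover have "(2 * int x - 1) * (int x - int K) \<le> int (card ?V) * (int x - int K)"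
      using v a by (intro mult_right_mono) auto
    ultimately have c: "(2 * int x - 1) * (int x - int K) \<le> int x * int x" by linarith
    have "(2 * int x - 1) * (2 * int x + 1) \<le> (2 * int x - 1) * (3 * (int x - int K))"
      using a X2(1) by (intro mult_left_mono) (auto simp: x_def)
    with c have "(2 * int x - 1) * (2 * int x + 1) \<le> 3 * (int x * int x)" by linarith
    moreover have "int x * int x \<ge> 2 * int x" using X2(1) by (intro mult_right_mono) (auto simp: x_def)
    moreover have "(2 * int x - 1) * (2 * int x + 1) = 4 * (int x * int x) - 1" by (simp add: algebra_simps)
    ultimately show False using X2(1) unfolding x_def by linarith
  qed
  have "i * d \<le> 2 * x" unfolding i_def by simp
  \<comment> \<open>The two terms of \<open>K\<close> contribute 18 and 3 to the constant 21, once
    \<open>i * d <= 2 * x\<close> is used and \<open>x\<close>, \<open>d\<close> are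
    compared.\<close>
  have "x * d \<le> 3 * K * d" using K3 by simp
  also have "\<dots> = 9 * (i * d) * k + 3 * d * k" unfolding K_def by (simp add: algebra_simps)
  also have "\<dots> \<le> 9 * (2 * x) * k + 3 * d * k" using \<open>i * d \<le> 2 * x\<close> by (simp add: mult.commute)
  finally have xd: "x * d \<le> 18 * x * k + 3 * d * k" by simp
  have "min x d \<le> 21 * k"
  proof (cases "d \<le> x")
    case True
    then have "3 * d * k \<le> 3 * x * k" by simp
    then have "x * d \<le> x * (21 * k)" using xd by linarith
    then show ?thesis using X2(1) by (auto simp: x_def)
  next
    case False
    then have "18 * x * k \<le> 18 * d * k" by simp
    then have "x * d \<le> 21 * k * d" using xd by (simp only: mult.commute mult.left_commute)
    then show ?thesis using d by auto
  qed
  then show ?thesis using w0 by (auto simp: x_def)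
qed

section \<open>Subset sums modulo \<open>m\<close>\<close>

lemma residue_sums_subset: "m > 0 \<Longrightarrow> residue_sums m T \<subseteq> {0..<m}"
  unfolding residue_sums_def by auto

lemma finite_residue_sums: "finite T \<Longrightarrow> finite (residue_sums m T)"
  unfolding residue_sums_def by auto

lemma zero_in_residue_sums: "0 \<in> residue_sums m T"
  unfolding residue_sums_def by (rule image_eqI[of _ _ "{}"]) auto

lemma residue_sums_mono: "S \<subseteq> T \<Longrightarrow> residue_sums m S \<subseteq> residue_sums m T"
  unfolding residue_sums_def by auto

text \<open>The elements counted by the defect are moved by \<open>x\<close> to distinct residues
  outside the old set, each attained by a sum that uses \<open>x\<close>.\<close>

lemma card_residue_sums_insert:
  assumes m: "m > 0" and T: "finite T" "x \<notin> T"
  shows "card (residue_sums m T) + shift_defect m (residue_sums m T) x \<le> card (residue_sums m (insert x T))"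
proof -
  let ?X = "residue_sums m T"
  let ?D = "{y \<in> ?X. (y + x) mod m \<notin> ?X}"
  let ?f = "\<lambda>y. (y + x) mod m"
  have fin: "finite ?X" by (rule finite_residue_sums[OF T(1)])
  have "inj_on ?f ?D" using residue_sums_subset[OF m, of T] by (intro inj_on_shift_mod) auto
  then have "card ?X + shift_defect m ?X x = card ?X + card (?f ` ?D)"
    unfolding shift_defect_def by (simp add: card_image)
  also have "\<dots> = card (?X \<union> ?f ` ?D)" using fin by (intro card_Un_disjoint[symmetric]) auto
  also have "\<dots> \<le> card (residue_sums m (insert x T))"
  proof (rule card_mono)
    show "finite (residue_sums m (insert x T))" using T by (intro finite_residue_sums) auto
    have "?f y \<in> residue_sums m (insert x T)" if y: "y \<in> ?X" for y
    proof -
      obtain S where S: "S \<subseteq> T" "y = \<Sum>S mod m" using y unfolding residue_sums_def by auto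
      have "finite S" "x \<notin> S" using S(1) T finite_subset by auto
      then have "?f y = \<Sum>(insert x S) mod m" by (simp add: S(2) mod_add_left_eq mod_add_right_eq add.commute)
      then show ?thesis unfolding residue_sums_def using S(1) by (intro image_eqI[of _ _ "insert x S"]) auto
    qed
    then show "?X \<union> ?f ` ?D \<subseteq> residue_sums m (insert x T)"
      using residue_sums_mono[of T "insert x T" m] by auto
  qed
  finally show ?thesis .
qed

text \<open>Otherwise the union of the two underlying subsets would be nonempty with sum divisible
  by \<open>m\<close>.\<close>

lemma residue_sums_neg_disjoint:
  assumes A: "finite A" and zsf: "\<And>S. S \<subseteq> A \<Longrightarrow> S \<noteq> {} \<Longrightarrow> \<not> m dvd \<Sum>S"
    and T: "T1 \<subseteq> A" "T2 \<subseteq> A" "T1 \<inter> T2 = {}"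
    and x: "x \<in> residue_sums m T1" and y: "y \<in> residue_sums m T2" and xy: "m dvd x + y"
  shows "x = 0 \<and> y = 0"
proof -
  obtain S1 where S1: "S1 \<subseteq> T1" "x = \<Sum>S1 mod m" using x unfolding residue_sums_def by auto
  obtain S2 where S2: "S2 \<subseteq> T2" "y = \<Sum>S2 mod m" using y unfolding residue_sums_def by auto
  have "finite S1" "finite S2" using S1(1) S2(1) T A by (meson finite_subset)+
  then have "\<Sum>(S1 \<union> S2) = \<Sum>S1 + \<Sum>S2"
    using S1(1) S2(1) T by (intro sum.union_disjoint) auto
  moreover have "m dvd \<Sum>S1 + \<Sum>S2"
    using xy unfolding S1(2) S2(2) dvd_eq_mod_eq_0 by (simp add: mod_add_eq)
  ultimately have "S1 \<union> S2 = {}" using zsf[of "S1 \<union> S2"] S1(1) S2(1) T by auto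
  then show ?thesis using S1 S2 by auto
qed

text \<open>The negatives of the nonzero sums of \<open>T2\<close> avoid the sums of
  \<open>T1\<close>; the \<open>+ 1\<close> accounts for the residue 0 common to both.\<close>

lemma card_residue_sums_add_le:
  assumes m: "m > 0" and A: "finite A" and zsf: "\<And>S. S \<subseteq> A \<Longrightarrow> S \<noteq> {} \<Longrightarrow> \<not> m dvd \<Sum>S"
    and T: "T1 \<subseteq> A" "T2 \<subseteq> A" "T1 \<inter> T2 = {}"
  shows "int (card (residue_sums m T1)) + int (card (residue_sums m T2)) \<le> m + 1"
proof -
  let ?X = "residue_sums m T1" and ?Y = "residue_sums m T2"
  let ?Z = "(\<lambda>y. (- y) mod m) ` (?Y - {0})"
  have fX: "finite ?X" and fY: "finite ?Y" using T A by (auto intro!: finite_residue_sums intro: finite_subset)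
  have "inj_on (\<lambda>y. (- y) mod m) (?Y - {0})"
  proof (rule inj_onI)
    fix y z assume "y \<in> ?Y - {0}" "z \<in> ?Y - {0}" and eq: "(- y) mod m = (- z) mod m"
    then have "y mod m = y" "z mod m = z" using residue_sums_subset[OF m, of T2] by (auto simp: subset_iff)
    then show "y = z" using eq by (metis minus_minus mod_minus_eq)
  qed
  then have "card ?Z = card ?Y - 1"
    using fY zero_in_residue_sums by (simp add: card_image)
  moreover have "card ?Y > 0" using fY zero_in_residue_sums by (auto simp: card_gt_0_iff)
  moreover have "?X \<inter> ?Z = {}"
  proof (rule ccontr)
    assume "?X \<inter> ?Z \<noteq> {}"
    then obtain y where y: "y \<in> ?Y" "y \<noteq> 0" "(- y) mod m \<in> ?X" by auto
    have "m dvd (- y) mod m + y" by (simp add: dvd_eq_mod_eq_0 mod_add_left_eq)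
    then show False using residue_sums_neg_disjoint[OF A zsf T y(3,1)] y(2) by auto
  qed
  then have "card ?X + card ?Z = card (?X \<union> ?Z)" using fX fY by (intro card_Un_disjoint[symmetric]) auto
  moreover have "card (?X \<union> ?Z) \<le> card {0..<m}"
    using residue_sums_subset[OF m, of T1] m by (intro card_mono) auto
  ultimately show ?thesis using m by simp
qed

text \<open>With zero defect, translation by \<open>x\<close> would permute the sums of
  \<open>T\<close>, so one of them would be carried to 0.\<close>

lemma shift_defect_residue_sums_pos:
  assumes m: "m > 0" and A: "finite A" and zsf: "\<And>S. S \<subseteq> A \<Longrightarrow> S \<noteq> {} \<Longrightarrow> \<not> m dvd \<Sum>S"
    and T: "T \<subseteq> A" and x: "x \<in> A - T"
  shows "0 < shift_defect m (residue_sums m T) x"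
proof (rule ccontr)
  let ?X = "residue_sums m T"
  let ?f = "\<lambda>y. (y + x) mod m"
  assume "\<not> 0 < shift_defect m ?X x"
  have fX: "finite ?X" using T A by (auto intro!: finite_residue_sums intro: finite_subset)
  then have "?f ` ?X \<subseteq> ?X" using \<open>\<not> 0 < shift_defect m ?X x\<close> unfolding shift_defect_def by auto
  moreover have "inj_on ?f ?X" by (rule inj_on_shift_mod[OF residue_sums_subset[OF m]])
  ultimately have "?f ` ?X = ?X" using fX by (simp add: endo_inj_surj)
  then obtain y where y: "y \<in> ?X" "(y + x) mod m = 0" using zero_in_residue_sums[of m T] by force
  have "x mod m \<in> residue_sums m {x}" unfolding residue_sums_def by (rule image_eqI[of _ _ "{x}"]) auto
  moreover have "m dvd y + x mod m" using y(2) by (simp add: dvd_eq_mod_eq_0 mod_add_right_eq)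
  ultimately have "x mod m = 0"
    using residue_sums_neg_disjoint[OF A zsf T, of "{x}" y "x mod m"] x y(1) by auto
  then show False using zsf[of "{x}"] x by auto
qed

section \<open>Greedy growth of the subset sums\<close>

lemma greedy_residue_sums:
  fixes m :: int and A R :: "int set" and d s t :: nat
  assumes m: "m > 0" and A: "finite A" and zsf: "\<And>S. S \<subseteq> A \<Longrightarrow> S \<noteq> {} \<Longrightarrow> \<not> m dvd \<Sum>S"
    and R: "R \<subseteq> A" "card A \<le> card R + 2 * s" and s: "0 < s" "4 * s < card A" and d: "0 < d"
    and distinct: "\<And>U. U \<subseteq> A \<Longrightarrow> card A \<le> card U + 4 * s \<Longrightarrow> d \<le> card ((\<lambda>u. u mod m) ` U)"
    and gen: "\<And>U q. U \<subseteq> A \<Longrightarrow> card A \<le> card U + 4 * s \<Longrightarrow> q > 1 \<Longrightarrow> q dvd m \<Longrightarrow> \<exists>u\<in>U. \<not> q dvd u"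
    and t: "t \<le> 2 * s"
  shows "\<exists>T\<subseteq>R. card T = t \<and> (2 * int (card (residue_sums m T)) \<le> m + 1 \<longrightarrow>
     t + 1 \<le> card (residue_sums m T) \<and> (t - s) * min s d \<le> 21 * card (residue_sums m T))"
  using t
proof (induction t)
  case 0
  have "residue_sums m {} = {0}" unfolding residue_sums_def by auto
  then show ?case by (intro exI[of _ "{}"]) auto
next
  case (Suc t)
  then obtain T where T: "T \<subseteq> R" "card T = t" and
    IH: "2 * int (card (residue_sums m T)) \<le> m + 1 \<Longrightarrow>
     t + 1 \<le> card (residue_sums m T) \<and> (t - s) * min s d \<le> 21 * card (residue_sums m T)"
    by auto
  let ?X = "residue_sums m T"
  have finR: "finite R" and finT: "finite T" using R(1) T(1) A finite_subset by (blast, metis finite_subset)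
  define U where "U = R - T"
  have "card U = card R - t" unfolding U_def using T finT by (simp add: card_Diff_subset)
  then have cU: "card A \<le> card U + 4 * s" and "U \<noteq> {}" using R(2) s(2) Suc.prems by auto
  have U: "U \<subseteq> A" "finite U" unfolding U_def using R finR by auto
  have pos: "0 < shift_defect m ?X x" if "x \<in> U" for x
    using shift_defect_residue_sums_pos[OF m A zsf, of T x] that T R U_def by auto
  have "\<exists>x\<in>U. s \<le> t \<longrightarrow> 2 * int (card ?X) \<le> m + 1 \<longrightarrow> min s d \<le> 21 * shift_defect m ?X x"
  proof (cases "s \<le> t \<and> 2 * int (card ?X) \<le> m + 1")
    case True
    then have "s + 1 \<le> card ?X" using IH by simp
    then obtain x where "x \<in> U" "min (card ?X) d \<le> 21 * shift_defect m ?X x"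
      using exists_large_shift_defect[OF residue_sums_subset[OF m], of T U d] True s(1) U d
        distinct[OF U(1) cU] gen[OF U(1) cU] by auto
    then show ?thesis using \<open>s + 1 \<le> card ?X\<close> by (intro bexI[of _ x]) auto
  next
    case False
    then show ?thesis using \<open>U \<noteq> {}\<close> by auto
  qed
  then obtain x where x: "x \<in> U"
    "s \<le> t \<Longrightarrow> 2 * int (card ?X) \<le> m + 1 \<Longrightarrow> min s d \<le> 21 * shift_defect m ?X x" by auto
  have "x \<notin> T" "x \<in> R" using x U_def by auto
  let ?X' = "residue_sums m (insert x T)"
  have ins: "card ?X + shift_defect m ?X x \<le> card ?X'"
    using card_residue_sums_insert[OF m finT \<open>x \<notin> T\<close>] .
  have "Suc t + 1 \<le> card ?X' \<and> (Suc t - s) * min s d \<le> 21 * card ?X'"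
    if "2 * int (card ?X') \<le> m + 1"
  proof -
    have le: "2 * int (card ?X) \<le> m + 1" using that ins by linarith
    have "(Suc t - s) * min s d \<le> 21 * card ?X'"
    proof (cases "s \<le> t")
      case True
      then have "(Suc t - s) * min s d = (t - s) * min s d + min s d" by (simp add: Suc_diff_le)
      then show ?thesis using IH[OF le] x(2)[OF True le] ins by linarith
    qed simp
    then show ?thesis using IH[OF le] ins pos[OF x(1)] by linarith
  qed
  then show ?case using T \<open>x \<notin> T\<close> \<open>x \<in> R\<close> finT by (intro exI[of _ "insert x T"]) auto
qed

lemma modulus_lower_bound:
  fixes m :: int and A :: "int set" and d s :: nat
  assumes m: "m > 0" and A: "finite A" and zsf: "\<And>S. S \<subseteq> A \<Longrightarrow> S \<noteq> {} \<Longrightarrow> \<not> m dvd \<Sum>S"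
    and s: "0 < s" "4 * s < card A" and d: "0 < d"
    and distinct: "\<And>U. U \<subseteq> A \<Longrightarrow> card A \<le> card U + 4 * s \<Longrightarrow> d \<le> card ((\<lambda>u. u mod m) ` U)"
    and gen: "\<And>U q. U \<subseteq> A \<Longrightarrow> card A \<le> card U + 4 * s \<Longrightarrow> q > 1 \<Longrightarrow> q dvd m \<Longrightarrow> \<exists>u\<in>U. \<not> q dvd u"
  shows "int (s * min s d) \<le> 21 * m"
proof -
  note greedy = greedy_residue_sums[OF m A zsf _ _ s d distinct gen, where t = "2 * s"]
  obtain T1 where T1: "T1 \<subseteq> A" "card T1 = 2 * s"
    "2 * int (card (residue_sums m T1)) \<le> m + 1 \<Longrightarrow> (2 * s - s) * min s d \<le> 21 * card (residue_sums m T1)"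
    using greedy[of A] by auto
  have "finite T1" using T1 A finite_subset by blast
  then have "card A \<le> card (A - T1) + 2 * s" using T1 by (simp add: card_Diff_subset)
  then obtain T2 where T2: "T2 \<subseteq> A - T1"
    "2 * int (card (residue_sums m T2)) \<le> m + 1 \<Longrightarrow> (2 * s - s) * min s d \<le> 21 * card (residue_sums m T2)"
    using greedy[of "A - T1"] by auto
  \<comment> \<open>Of two disjoint greedy choices at least one has at most half of all residues as subset sums,
    so its growth was never obstructed by saturation.\<close>
  have "int (card (residue_sums m T1)) + int (card (residue_sums m T2)) \<le> m + 1"
    using T2 T1 by (intro card_residue_sums_add_le[OF m A zsf]) auto
  then obtain T where T: "s * min s d \<le> 21 * card (residue_sums m T)"
  proof (cases "2 * int (card (residue_sums m T1)) \<le> m + 1")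
    case True
    then show ?thesis using T1(3) that[of T1] by simp
  next
    case False
    then have "2 * int (card (residue_sums m T2)) \<le> m + 1"
      using \<open>_ \<le> m + 1\<close> by linarith
    then show ?thesis using T2(2) that[of T2] by simp
  qed
  have "card (residue_sums m T) \<le> card {0..<m}" by (intro card_mono residue_sums_subset m) auto
  then have "21 * card (residue_sums m T) \<le> 21 * nat m" by simp
  with T have "s * min s d \<le> 21 * nat m" by (rule order_trans)
  then show ?thesis using m by (metis of_nat_le_iff of_nat_mult of_nat_numeral nat_0_le less_imp_le)
qed

text \<open>If every such \<open>U\<close> met more classes, \<open>modulus_lower_bound\<close>
  would apply with a \<open>d\<close> too large for the modulus. The constant 840 is
  \<open>21 * 40\<close>, from \<open>n <= 40 * s\<close>.\<close>

lemma exists_concentrated_subset: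
  fixes m :: int and A :: "int set"
  assumes m: "m > 0" and A: "finite A" and zsf: "\<And>S. S \<subseteq> A \<Longrightarrow> S \<noteq> {} \<Longrightarrow> \<not> m dvd \<Sum>S"
    and large: "100000 * m \<le> (int (card A))\<^sup>2"
    and primitive: "\<And>q. q > 1 \<Longrightarrow> q dvd m \<Longrightarrow> q * int (card {a \<in> A. q dvd a}) ^ 3 \<le> int (card A) ^ 3"
  shows "\<exists>U\<subseteq>A. 4 * card A \<le> 5 * card U \<and> int (card A) * int (card ((\<lambda>u. u mod m) ` U)) \<le> 840 * m"
proof (rule ccontr)
  assume neg: "\<not> ?thesis"
  define n where "n = card A"
  \<comment> \<open>Removing \<open>4 * s\<close> elements leaves at least four fifths of
    \<open>A\<close>; \<open>d\<close> is the least integer with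
    \<open>s * d > 21 * m\<close>.\<close>
  define s where "s = n div 20"
  define d where "d = nat (21 * m div int s) + 1"
  have n20: "20 \<le> n"
  proof (rule ccontr)
    assume "\<not> 20 \<le> n"
    then have "(int n)\<^sup>2 \<le> 20\<^sup>2" by (intro power_mono) auto
    then show False using large m by (simp add: n_def)
  qed
  have s: "0 < s" "20 * s \<le> n" "n \<le> 40 * s" using n20 unfolding s_def by presburger+
  \<comment> \<open>Largeness of \<open>A\<close> gives \<open>s^2 > 21 * m\<close>, so
    \<open>min s d\<close> is too large whichever term attains it.\<close>
  have "(int n)\<^sup>2 \<le> (40 * int s)\<^sup>2" using s by (intro power_mono) auto
  then have ss: "21 * m < int s * int s" using large m by (simp add: n_def power2_eq_square)
  have dval: "int d = 21 * m div int s + 1" using m s unfolding d_def by (simp add: pos_imp_zdiv_nonneg_iff)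
  have "21 * m = (21 * m div int s) * int s + 21 * m mod int s" by simp
  moreover have "21 * m mod int s < int s" using s by simp
  ultimately have sd: "21 * m < int s * int d"
    unfolding dval distrib_left by (simp only: mult.commute[of "int s"])
  have big: "21 * m < int (s * min s d)" using ss sd by (simp add: min_def)
  have U54: "4 * n \<le> 5 * card U" if "card A \<le> card U + 4 * s" for U :: "int set"
    using that s unfolding n_def by linarith
  have "int (s * min s d) \<le> 21 * m"
  proof (rule modulus_lower_bound[OF m A zsf])
    show "0 < s" "4 * s < card A" "0 < d" using s unfolding n_def[symmetric] d_def by auto
    show "d \<le> card ((\<lambda>u. u mod m) ` U)" if U: "U \<subseteq> A" "card A \<le> card U + 4 * s" for U
    proof (rule ccontr)
      let ?c = "card ((\<lambda>u. u mod m) ` U)"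
      assume "\<not> d \<le> ?c"
      then have "int ?c \<le> 21 * m div int s" using dval by linarith
      then have "int s * int ?c \<le> int s * (21 * m div int s)" by (intro mult_left_mono) auto
      also have "\<dots> \<le> 21 * m" using s by (simp add: mult.commute[of "int s"] minus_mod_eq_div_mult[symmetric])
      finally have "40 * (int s * int ?c) \<le> 840 * m" by simp
      moreover have "int n * int ?c \<le> (40 * int s) * int ?c" using s by (intro mult_right_mono) auto
      ultimately have "int n * int ?c \<le> 840 * m" by simp
      then show False using neg U U54[OF U(2)] unfolding n_def by auto
    qed
    show "\<exists>u\<in>U. \<not> q dvd u" if U: "U \<subseteq> A" "card A \<le> card U + 4 * s" and q: "q > 1" "q dvd m" for U q
    proof (rule ccontr)
      assume "\<not> ?thesis"
      then have "U \<subseteq> {a \<in> A. q dvd a}" using U by auto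
      then have "card U \<le> card {a \<in> A. q dvd a}" using A by (intro card_mono) auto
      then have "4 * int n \<le> 5 * int (card {a \<in> A. q dvd a})" using U54[OF U(2)] by linarith
      \<comment> \<open>Four fifths suffice because \<open>2 * (4/5)^3 = 128/125 > 1\<close>, which
        contradicts \<open>primitive\<close> for every \<open>q >= 2\<close>.\<close>
      then have "(4 * int n) ^ 3 \<le> (5 * int (card {a \<in> A. q dvd a})) ^ 3" by (intro power_mono) auto
      then have "64 * int n ^ 3 \<le> 125 * int (card {a \<in> A. q dvd a}) ^ 3" by (simp add: power_mult_distrib)
      moreover have "2 * int (card {a \<in> A. q dvd a}) ^ 3 \<le> q * int (card {a \<in> A. q dvd a}) ^ 3"
        using q by (intro mult_right_mono) auto
      moreover have "0 < int n ^ 3" using n20 by simp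
      ultimately show False using primitive[OF q] unfolding n_def by linarith
    qed
  qed
  then show False using big by simp
qed

section \<open>Counting congruent pairs\<close>

text \<open>Cauchy--Schwarz over the fibres of \<open>f\<close>: their sizes sum to
  \<open>card U\<close>, and the squares of the sizes count the coinciding pairs.\<close>

lemma card_squared_le_image_times_collisions:
  assumes U: "finite U"
  shows "(card U)\<^sup>2 \<le> card (f ` U) * card {(x, y). x \<in> U \<and> y \<in> U \<and> f x = f y}"
proof -
  define F where "F r = {x \<in> U. f x = r}" for r
  have finF: "finite (F r)" for r unfolding F_def using U by auto
  have "U = (\<Union>r\<in>f ` U. F r)" unfolding F_def by auto
  then have "card U = card (\<Union>r\<in>f ` U. F r)" by simp
  also have "\<dots> = (\<Sum>r\<in>f ` U. card (F r))"
    using U finF by (intro card_UN_disjoint) (auto simp: F_def)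
  finally have c1: "card U = (\<Sum>r\<in>f ` U. card (F r))" .
  have "{(x, y). x \<in> U \<and> y \<in> U \<and> f x = f y} = (\<Union>r\<in>f ` U. F r \<times> F r)" unfolding F_def by auto
  also have "card \<dots> = (\<Sum>r\<in>f ` U. card (F r \<times> F r))"
    using U finF by (intro card_UN_disjoint) (auto simp: F_def)
  finally have c2: "card {(x, y). x \<in> U \<and> y \<in> U \<and> f x = f y} = (\<Sum>r\<in>f ` U. (card (F r))\<^sup>2)"
    by (simp add: card_cartesian_product power2_eq_square)
  have "(\<Sum>r\<in>f ` U. real (card (F r)))\<^sup>2 \<le> (\<Sum>r\<in>f ` U. (real (card (F r)))\<^sup>2) * card (f ` U)"
    by (rule sum_squared_le_sum_of_squares)
  then have "real ((card U)\<^sup>2) \<le> real (card (f ` U) * card {(x, y). x \<in> U \<and> y \<in> U \<and> f x = f y})"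
    unfolding c1 c2 by (simp add: mult.commute)
  then show ?thesis by (simp only: of_nat_le_iff)
qed

text \<open>The elements divisible by a maximising \<open>g\<close> are divided by \<open>g\<close>
  and studied modulo \<open>b div g\<close>. The cube in the maximised weight matches the cube in
  the conclusion, so the bound returns to \<open>A\<close> without loss.\<close>

lemma collisions_lower_bound:
  fixes b :: int and A :: "int set"
  assumes b: "b > 0" and A: "finite A" and zsf: "\<And>S. S \<subseteq> A \<Longrightarrow> S \<noteq> {} \<Longrightarrow> \<not> b dvd \<Sum>S"
    and large: "100000 * b \<le> (int (card A))\<^sup>2"
  shows "int (card A) ^ 3 \<le> 1400 * b * int (card {(x, y). x \<in> A \<and> y \<in> A \<and> x \<noteq> y \<and> b dvd x - y})"
proof -
  define n where "n = int (card A)"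
  \<comment> \<open>For \<open>g\<close> dividing \<open>b\<close>, this is \<open>b\<close> times
    \<open>|A \<inter> H|^3 / |H|\<close>, where \<open>H\<close> is the group of multiples of
    \<open>g\<close> modulo \<open>b\<close>, of order \<open>b div g\<close>.\<close>
  define w where "w g = g * int (card {a \<in> A. g dvd a}) ^ 3" for g
  let ?D = "{g. 0 < g \<and> g dvd b}"
  have finD: "finite ?D" by (rule finite_subset[of _ "{0..b}"]) (use b zdvd_imp_le in auto)
  have "?D \<noteq> {}" by (auto intro: exI[of _ 1])
  then have "Max (w ` ?D) \<in> w ` ?D" using finD by (intro Max_in) auto
  then obtain g where g: "0 < g" "g dvd b" and "Max (w ` ?D) = w g" by auto
  \<comment> \<open>Maximality of \<open>g\<close> forces every proper subgroup of the subgroup generated by \<open>g\<close> modulo \<open>b\<close>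
    to miss a positive proportion of the elements of \<open>A\<close> divisible by \<open>g\<close>.\<close>
  then have max: "w h \<le> w g" if "0 < h" "h dvd b" for h
    using finD that Max_ge[of "w ` ?D" "w h"] by auto
  define m where "m = b div g"
  have bgm: "b = g * m" unfolding m_def using g by simp
  have m: "m > 0" using b g bgm by (simp add: zero_less_mult_iff)
  define A' where "A' = {a. g * a \<in> A}"
  have inj: "inj_on ((*) g) S" for S using g by (auto intro: inj_onI)
  have imgA': "(*) g ` {a \<in> A'. q dvd a} = {a \<in> A. q * g dvd a}" for q
  proof
    show "(*) g ` {a \<in> A'. q dvd a} \<subseteq> {a \<in> A. q * g dvd a}"
      unfolding A'_def by (auto simp: mult.commute[of q])
    show "{a \<in> A. q * g dvd a} \<subseteq> (*) g ` {a \<in> A'. q dvd a}"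
    proof
      fix a assume "a \<in> {a \<in> A. q * g dvd a}"
      then obtain k where "a \<in> A" "a = g * (q * k)" by (auto elim!: dvdE simp: mult.assoc mult.left_commute[of q])
      then show "a \<in> (*) g ` {a \<in> A'. q dvd a}" unfolding A'_def by auto
    qed
  qed
  have cardA': "card {a \<in> A'. q dvd a} = card {a \<in> A. q * g dvd a}" for q
    using imgA'[of q] card_image[OF inj, of "{a \<in> A'. q dvd a}"] by simp
  have finA': "finite A'" unfolding A'_def by (rule finite_vimageI[OF A inj, unfolded vimage_def])
  define n' where "n' = int (card A')"
  have wg: "w g = g * n' ^ 3" using cardA'[of 1] unfolding w_def n'_def by simp
  have n3: "n ^ 3 \<le> g * n' ^ 3" using max[of 1] unfolding wg by (simp add: w_def n_def)
  have npos: "n > 0" using large b by (cases "card A = 0") (auto simp: n_def)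
  have n'le: "n' \<le> n"
    using cardA'[of 1] A unfolding n'_def n_def by (simp add: card_mono)
  have n'pos: "n' > 0"
    using n3 npos g by (cases "n' = 0") (auto simp: n'_def)
  have zsf': "\<not> m dvd \<Sum>S" if S: "S \<subseteq> A'" "S \<noteq> {}" for S
  proof
    assume "m dvd \<Sum>S"
    then have "b dvd g * \<Sum>S" unfolding bgm by (rule mult_dvd_mono[OF dvd_refl])
    also have "g * \<Sum>S = \<Sum>((*) g ` S)" using inj by (simp add: sum.reindex sum_distrib_left)
    finally show False using zsf[of "(*) g ` S"] S unfolding A'_def by auto
  qed
  \<comment> \<open>From \<open>n^3 <= g * n'^3\<close> and \<open>n' <= n\<close> it follows that
    \<open>n'^2 / m >= n^2 / b\<close>.\<close>
  have large': "100000 * m \<le> n'\<^sup>2"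
  proof -
    have "(g * n') * (100000 * m) = n' * (100000 * b)" by (simp add: bgm)
    also have "\<dots> \<le> n * (n\<^sup>2)" using n'le n'pos b large unfolding n_def by (intro mult_mono) auto
    also have "\<dots> = n ^ 3" by (simp add: power2_eq_square power3_eq_cube)
    also have "\<dots> \<le> (g * n') * n'\<^sup>2" using n3 by (simp add: power2_eq_square power3_eq_cube mult.assoc)
    finally show ?thesis using g n'pos by simp
  qed
  have primitive: "q * int (card {a \<in> A'. q dvd a}) ^ 3 \<le> int (card A') ^ 3" if q: "q > 1" "q dvd m" for q
  proof -
    have "q * g dvd b" unfolding bgm using q by (simp add: mult.commute[of q])
    then have "w (q * g) \<le> w g" using q g by (intro max) auto
    then have "g * (q * int (card {a \<in> A'. q dvd a}) ^ 3) \<le> g * n' ^ 3"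
      using cardA'[of q] q unfolding wg by (simp add: w_def algebra_simps)
    then show ?thesis using g unfolding n'_def by simp
  qed
  obtain U where U: "U \<subseteq> A'" "4 * card A' \<le> 5 * card U"
    "n' * int (card ((\<lambda>u. u mod m) ` U)) \<le> 840 * m"
    using exists_concentrated_subset[OF m finA' zsf' large'[unfolded n'_def] primitive] unfolding n'_def by auto
  have finU: "finite U" using U finA' finite_subset by blast
  define c where "c = int (card ((\<lambda>u. u mod m) ` U))"
  define P where "P = {(x, y). x \<in> U \<and> y \<in> U \<and> x mod m = y mod m}"
  define P' where "P' = {(x, y). x \<in> U \<and> y \<in> U \<and> x \<noteq> y \<and> x mod m = y mod m}"
  have "P = P' \<union> (\<lambda>x. (x, x)) ` U" unfolding P_def P'_def by auto
  then have "card P \<le> card P' + card ((\<lambda>x. (x, x)) ` U)" by (simp add: card_Un_le)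
  also have "card ((\<lambda>x. (x, x)) ` U) \<le> card A'"
    by (rule order_trans[OF card_image_le[OF finU] card_mono[OF finA' U(1)]])
  finally have PP': "int (card P) \<le> int (card P') + n'" unfolding n'_def by simp
  have "(int (card U))\<^sup>2 \<le> c * int (card P)"
    using card_squared_le_image_times_collisions[OF finU, of "\<lambda>u. u mod m", THEN of_nat_mono[where 'a = int]]
    unfolding c_def P_def by simp
  moreover have "(4 * n')\<^sup>2 \<le> (5 * int (card U))\<^sup>2"
    using U(2) unfolding n'_def by (intro power_mono) auto
  ultimately have "16 * n'\<^sup>2 \<le> 25 * (c * int (card P))" by (simp add: power_mult_distrib)
  then have "n' * (16 * n'\<^sup>2) \<le> n' * (25 * (c * int (card P)))" using n'pos by (intro mult_left_mono) auto
  then have "16 * n' ^ 3 \<le> 25 * ((n' * c) * int (card P))"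
    by (simp add: power2_eq_square power3_eq_cube algebra_simps)
  also have "\<dots> \<le> 25 * ((840 * m) * (int (card P') + n'))"
    by (rule mult_left_mono, rule mult_mono[OF U(3)[folded c_def] PP']) (use m in auto)
  finally have "16 * n' ^ 3 \<le> 21000 * (m * int (card P')) + 21000 * (m * n')" by (simp add: algebra_simps)
  moreover have "100000 * (m * n') \<le> n' ^ 3"
    using mult_right_mono[OF large', of n'] n'pos by (simp add: power2_eq_square power3_eq_cube algebra_simps)
  moreover have "0 \<le> m * int (card P')" using m by simp
  \<comment> \<open>The diagonal pairs cost at most \<open>0.21 * n'^3\<close>, and
    \<open>21000 / 15.79 < 1400\<close>.\<close>
  ultimately have "n' ^ 3 \<le> 1400 * (m * int (card P'))" by linarith
  then have "g * n' ^ 3 \<le> g * (1400 * (m * int (card P')))" using g by (intro mult_left_mono) auto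
  then have main: "n ^ 3 \<le> 1400 * b * int (card P')" using n3 unfolding bgm by (simp add: algebra_simps)
  let ?Q = "{(x, y). x \<in> A \<and> y \<in> A \<and> x \<noteq> y \<and> b dvd x - y}"
  have "card P' \<le> card ?Q"
  proof (rule card_inj_on_le[of "\<lambda>(x, y). (g * x, g * y)"])
    show "inj_on (\<lambda>(x, y). (g * x, g * y)) P'" using g by (auto intro!: inj_onI)
    show "(\<lambda>(x, y). (g * x, g * y)) ` P' \<subseteq> ?Q"
      using U(1) g unfolding P'_def A'_def bgm
      by (auto simp: right_diff_distrib[symmetric] mod_eq_dvd_iff)
    show "finite ?Q" by (rule finite_subset[of _ "A \<times> A"]) (use A in auto)
  qed
  then have "1400 * b * int (card P') \<le> 1400 * b * int (card ?Q)" using b by simp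
  then show ?thesis using main unfolding n_def by linarith
qed

section \<open>Larger sieve\<close>

lemma prod_dvd_of_pairwise_coprime:
  fixes F :: "int set"
  assumes "finite F" "pairwise coprime F" "\<And>b. b \<in> F \<Longrightarrow> b dvd z"
  shows "\<Prod>F dvd z"
  using assms
proof (induction F rule: finite_induct)
  case (insert b F)
  have "coprime b (\<Prod>F)"
    using insert by (intro prod_coprime_right) (auto simp: pairwise_insert)
  moreover have "\<Prod>F dvd z" using insert by (auto simp: pairwise_insert)
  ultimately show ?case using insert by (simp add: divides_mult)
qed simp

text \<open>The product of pairwise coprime divisors of \<open>z\<close> divides \<open>z\<close>,
  hence is at most \<open>|z|\<close>.\<close>

lemma sum_ln_divisors_le:
  fixes B :: "int set" and z :: int
  assumes B: "finite B" "pairwise coprime B" "\<And>b. b \<in> B \<Longrightarrow> 1 \<le> b" and z: "z \<noteq> 0"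
  shows "(\<Sum>b \<in> {b \<in> B. b dvd z}. ln (real_of_int b)) \<le> ln (real_of_int \<bar>z\<bar>)"
proof -
  let ?F = "{b \<in> B. b dvd z}"
  have "\<Prod>?F dvd z"
    using B by (intro prod_dvd_of_pairwise_coprime) (auto intro: pairwise_subset)
  then have le: "\<Prod>?F \<le> \<bar>z\<bar>" using z by (simp add: zdvd_imp_le)
  have pos: "0 < \<Prod>?F" using B(3) by (intro prod_pos) force
  have "(\<Sum>b\<in>?F. ln (real_of_int b)) = ln (\<Prod>b\<in>?F. real_of_int b)"
    using B by (intro ln_prod[symmetric]) force+
  also have "\<dots> = ln (real_of_int (\<Prod>?F))" by simp
  also have "\<dots> \<le> ln (real_of_int \<bar>z\<bar>)" using le pos by (intro ln_mono) (simp_all only: of_int_le_iff of_int_0_less_iff)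
  finally show ?thesis .
qed

theorem theorem1p4:
  "\<exists>c::real. c > 0 \<and> (\<exists>C::real. C > 0 \<and>
    (\<forall>(N::nat) (A::int set) (B::int set).
      N \<ge> 1 \<longrightarrow>
      A \<subseteq> {1..int N} \<longrightarrow>
      (\<forall>b\<in>B. 1 \<le> b \<and> real_of_int b \<le> c * (real (card A))\<^sup>2) \<longrightarrow>
      pairwise coprime B \<longrightarrow>
      (\<forall>b\<in>B. \<forall>s\<in>subset_sums A. \<not> b dvd s) \<longrightarrow>
      \<bar>real (card A) * (\<Sum>b\<in>B. ln (real_of_int b) / real_of_int b)\<bar> \<le> C * ln (real N)))"
\<comment> \<open>Both constants come from \<open>collisions_lower_bound\<close>; the sieve loses no
  further factor.\<close>
proof (rule exI[of _ "1 / 100000"], intro exI[of _ 1400] conjI allI impI)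
  fix N :: nat and A B :: "int set"
  assume N: "N \<ge> 1" and A: "A \<subseteq> {1..int N}"
    and B: "\<forall>b\<in>B. 1 \<le> b \<and> real_of_int b \<le> 1 / 100000 * (real (card A))\<^sup>2"
    and cop: "pairwise coprime B" and nd: "\<forall>b\<in>B. \<forall>s\<in>subset_sums A. \<not> b dvd s"
  define n where "n = card A"
  have finA: "finite A" using A finite_subset by blast
  have B1: "1 \<le> b" and Bn: "100000 * b \<le> (int n)\<^sup>2" if "b \<in> B" for b
  proof -
    show "1 \<le> b" using B that by auto
    have "real_of_int (100000 * b) \<le> real_of_int ((int n)\<^sup>2)" using B that unfolding n_def by force
    then show "100000 * b \<le> (int n)\<^sup>2" by (simp only: of_int_le_iff)
  qed
  have finB: "finite B"
    by (rule finite_subset[of _ "{1..(int n)\<^sup>2}"]) (use B1 Bn in force)+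
  define E where "E = {(x, y). x \<in> A \<and> y \<in> A \<and> x \<noteq> y}"
  have EA: "E \<subseteq> A \<times> A" unfolding E_def by auto
  have finE: "finite E" using EA finA finite_subset by blast
  define Q where "Q b = {p \<in> E. b dvd fst p - snd p}" for b
  have Qlow: "real n ^ 3 * (ln (real_of_int b) / real_of_int b) \<le> 1400 * (real (card (Q b)) * ln (real_of_int b))"
    if b: "b \<in> B" for b
  proof -
    have "\<not> b dvd \<Sum>S" if "S \<subseteq> A" "S \<noteq> {}" for S
      using nd b that finA finite_subset unfolding subset_sums_def by blast
    then have "int n ^ 3 \<le> 1400 * b * int (card {(x, y). x \<in> A \<and> y \<in> A \<and> x \<noteq> y \<and> b dvd x - y})"
      using B1[OF b] Bn[OF b] unfolding n_def by (intro collisions_lower_bound finA) auto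
    also have "{(x, y). x \<in> A \<and> y \<in> A \<and> x \<noteq> y \<and> b dvd x - y} = Q b" unfolding Q_def E_def by auto
    finally have "real_of_int (int n ^ 3) \<le> real_of_int (1400 * b * int (card (Q b)))" by (simp only: of_int_le_iff)
    then have "real n ^ 3 * (ln (real_of_int b) / real_of_int b)
        \<le> (1400 * real_of_int b * real (card (Q b))) * (ln (real_of_int b) / real_of_int b)"
      using B1[OF b] by (intro mult_right_mono) auto
    also have "\<dots> = 1400 * (real (card (Q b)) * ln (real_of_int b))" using B1[OF b] by simp
    finally show ?thesis .
  qed
  have "real n ^ 3 * (\<Sum>b\<in>B. ln (real_of_int b) / real_of_int b)
      \<le> 1400 * (\<Sum>b\<in>B. real (card (Q b)) * ln (real_of_int b))"
    unfolding sum_distrib_left by (rule sum_mono) (rule Qlow)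
  also have "(\<Sum>b\<in>B. real (card (Q b)) * ln (real_of_int b)) = (\<Sum>b\<in>B. \<Sum>p\<in>Q b. ln (real_of_int b))"
    by simp
  \<comment> \<open>After the exchange, each pair collects the logarithms of pairwise coprime
    divisors of its difference, at most \<open>ln N\<close> in total.\<close>
  also have "\<dots> = (\<Sum>p\<in>E. \<Sum>b \<in> {b \<in> B. b dvd fst p - snd p}. ln (real_of_int b))"
    unfolding Q_def using finB finE by (rule sum.swap_restrict)
  also have "\<dots> \<le> (\<Sum>p\<in>E. ln (real N))"
  proof (rule sum_mono)
    fix p assume p: "p \<in> E"
    have "1 \<le> fst p" "fst p \<le> int N" "1 \<le> snd p" "snd p \<le> int N" "fst p \<noteq> snd p"
      using A p unfolding E_def by (auto simp: subset_iff)
    then have z: "fst p - snd p \<noteq> 0" "\<bar>fst p - snd p\<bar> \<le> int N" by linarith+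
    have "(\<Sum>b \<in> {b \<in> B. b dvd fst p - snd p}. ln (real_of_int b)) \<le> ln (real_of_int \<bar>fst p - snd p\<bar>)"
      using finB cop B1 z(1) by (rule sum_ln_divisors_le)
    also have "\<dots> \<le> ln (real N)"
    proof (rule ln_mono)
      show "0 < real_of_int \<bar>fst p - snd p\<bar>" using z(1) by linarith
      show "real_of_int \<bar>fst p - snd p\<bar> \<le> real N" using z(2) by linarith
    qed
    finally show "(\<Sum>b \<in> {b \<in> B. b dvd fst p - snd p}. ln (real_of_int b)) \<le> ln (real N)" .
  qed
  also have "\<dots> \<le> (real n)\<^sup>2 * ln (real N)"
  proof -
    have "card E \<le> card (A \<times> A)" using EA finA by (intro card_mono) auto
    then have "card E \<le> n\<^sup>2" unfolding n_def by (simp add: card_cartesian_product power2_eq_square)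
    then have "real (card E) \<le> (real n)\<^sup>2" by (metis of_nat_le_iff of_nat_power)
    then show ?thesis using N by (simp add: mult_right_mono)
  qed
  finally have bound: "real n ^ 3 * (\<Sum>b\<in>B. ln (real_of_int b) / real_of_int b) \<le> 1400 * ((real n)\<^sup>2 * ln (real N))"
    by simp
  have nonneg: "0 \<le> (\<Sum>b\<in>B. ln (real_of_int b) / real_of_int b)" using B1 by (intro sum_nonneg) force
  have "real n * (\<Sum>b\<in>B. ln (real_of_int b) / real_of_int b) \<le> 1400 * ln (real N)"
  proof (cases "n = 0")
    case False
    have "(real n)\<^sup>2 * (real n * (\<Sum>b\<in>B. ln (real_of_int b) / real_of_int b)) \<le> (real n)\<^sup>2 * (1400 * ln (real N))"
      using bound by (simp add: power2_eq_square power3_eq_cube algebra_simps)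
    then show ?thesis using False by simp
  qed (use N in simp)
  then show "\<bar>real (card A) * (\<Sum>b\<in>B. ln (real_of_int b) / real_of_int b)\<bar> \<le> 1400 * ln (real N)"
    using nonneg unfolding n_def by simp
qed auto

end
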